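(* Let $k\geq 2$ and let $G_1,\ldots,G_k$ be graphs each of which is a complete graph $K_n$, a cycle $C_n$ or a path $P_n$ on some number $n\geq 3$ of vertices (possibly different types and different $n$ for different indices). Then $\mu(G_1\Box G_2\Box\cdots\Box G_k)\leq 3$. In particular, the following graphs have $\mu\le 3$ (all indices being at least $3$): $C_n\Box P_m$, $K_n\Box P_m$, $K_n\Box C_m$, $C_{n_1}\Box\cdots\Box C_{n_k}$, $P_{n_1}\Box\cdots\Box P_{n_k}$ and $K_{n_1}\Box\cdots\Box K_{n_k}$.
   Context: All graphs are finite and simple. $P_n$, $C_n$, $K_n$ denote the path, cycle and complete graph on $n$ vertices. A $k$-edge-weighting of a graph $G$ is a function $w:E(G)\to\{1,2,\ldots,k\}$. It induces a vertex coloring $c$ by $c(v)=\sum_{e\sim v}w(e)$, where $e\sim v$ means that $e$ is an edge incident to $v$. If $c$ is a proper vertex coloring ($c(u)\neq c(v)$ for every two adjacent vertices $u,v$), then $w$ is called a vertex-coloring $k$-edge-weighting (VC$k$-EW). $\mu(G)$ denotes the minimum $k$ for which $G$ has a VC$k$-EW. The Cartesian product $G\Box H$ has vertex set $V(G)\times V(H)$, with $(u,v)$ adjacent to $(u',v')$ if and only if $u=u'$ and $vv'\in E(H)$, or $v=v'$ and $uu'\in E(G)$. *)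

theory Defs
  imports Main "HOL-Library.Extended_Nat"
begin

record 'a sgraph =
  verts :: "'a set"
  edges :: "'a set set"

definition simple_graph :: "'a sgraph \<Rightarrow> bool" where
  "simple_graph G \<longleftrightarrow> finite (verts G) \<and> (\<forall>e\<in>edges G. e \<subseteq> verts G \<and> card e = 2)"

definition graph_iso :: "'a sgraph \<Rightarrow> 'b sgraph \<Rightarrow> bool"  (infix \<open>\<simeq>\<close> 50) where
  "G \<simeq> H \<longleftrightarrow> (\<exists>f. bij_betw f (verts G) (verts H) \<and>
     (\<forall>u\<in>verts G. \<forall>v\<in>verts G. {u, v} \<in> edges G \<longleftrightarrow> {f u, f v} \<in> edges H))"

definition complete_graph :: "nat \<Rightarrow> nat sgraph" where
  "complete_graph n = \<lparr>verts = {..<n}, edges = {{i, j} | i j. i < n \<and> j < n \<and> i \<noteq> j}\<rparr>"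

text \<open>The cycle is a simple graph with \<open>n\<close> edges only for \<open>n \<ge> 3\<close>.\<close>

definition cycle_graph :: "nat \<Rightarrow> nat sgraph" where
  "cycle_graph n = \<lparr>verts = {..<n}, edges = {{i, Suc i mod n} | i. i < n}\<rparr>"

definition path_graph :: "nat \<Rightarrow> nat sgraph" where
  "path_graph n = \<lparr>verts = {..<n}, edges = {{i, Suc i} | i. Suc i < n}\<rparr>"

definition cart_prod :: "'a sgraph \<Rightarrow> 'b sgraph \<Rightarrow> ('a \<times> 'b) sgraph"  (infixr \<open>\<box>\<close> 70) where
  "G \<box> H = \<lparr>verts = verts G \<times> verts H,
     edges = {{(u, v), (u', v')} | u v u' v'.
       u \<in> verts G \<and> u' \<in> verts G \<and> v \<in> verts H \<and> v' \<in> verts H \<and>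
       (u = u' \<and> {v, v'} \<in> edges H \<or> v = v' \<and> {u, u'} \<in> edges G)}\<rparr>"

definition relabel :: "('a \<Rightarrow> 'b) \<Rightarrow> 'a sgraph \<Rightarrow> 'b sgraph" where
  "relabel f G = \<lparr>verts = f ` verts G, edges = (\<lambda>e. f ` e) ` edges G\<rparr>"

text \<open>
  The product of a list of graphs is the iterated binary product, with the nested tuple
  \<open>(x\<^sub>1, (x\<^sub>2, \<dots>))\<close> flattened to the list \<open>[x\<^sub>1, x\<^sub>2, \<dots>]\<close> so that the number of factors
  can vary. The empty product is the one-vertex graph, the unit of the Cartesian product.
\<close>

fun cart_prod_list :: "'a sgraph list \<Rightarrow> 'a list sgraph" where
  "cart_prod_list [] = \<lparr>verts = {[]}, edges = {}\<rparr>"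
| "cart_prod_list (G # Gs) = relabel (\<lambda>(x, xs). x # xs) (G \<box> cart_prod_list Gs)"

definition edge_weighting :: "'a sgraph \<Rightarrow> nat \<Rightarrow> ('a set \<Rightarrow> nat) \<Rightarrow> bool" where
  "edge_weighting G k w \<longleftrightarrow> (\<forall>e\<in>edges G. w e \<in> {1..k})"

definition induced_coloring :: "'a sgraph \<Rightarrow> ('a set \<Rightarrow> nat) \<Rightarrow> 'a \<Rightarrow> nat" where
  "induced_coloring G w v = (\<Sum>e | e \<in> edges G \<and> v \<in> e. w e)"

definition proper_coloring :: "'a sgraph \<Rightarrow> ('a \<Rightarrow> nat) \<Rightarrow> bool" where
  "proper_coloring G c \<longleftrightarrow> (\<forall>u v. {u, v} \<in> edges G \<longrightarrow> c u \<noteq> c v)"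

definition vc_edge_weighting :: "'a sgraph \<Rightarrow> nat \<Rightarrow> ('a set \<Rightarrow> nat) \<Rightarrow> bool" where
  "vc_edge_weighting G k w \<longleftrightarrow>
     edge_weighting G k w \<and> proper_coloring G (induced_coloring G w)"

text \<open>
  Some graphs (those with a component \<open>K\<^sub>2\<close>) have no vertex-coloring edge-weighting at all; with
  values in \<^typ>\<open>enat\<close> the minimum over the empty set is \<open>\<infinity>\<close>, so that an upper bound on
  \<open>mu\<close> asserts existence.
\<close>

definition mu :: "'a sgraph \<Rightarrow> enat" where
  "mu G = Inf (enat ` {k. k \<ge> 1 \<and> (\<exists>w. vc_edge_weighting G k w)})"

lemma mu_le_iff:
  "mu G \<le> enat k \<longleftrightarrow> (\<exists>j\<ge>1. j \<le> k \<and> (\<exists>w. vc_edge_weighting G j w))"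
proof
  let ?S = "enat ` {k. k \<ge> 1 \<and> (\<exists>w. vc_edge_weighting G k w)}"
  assume "mu G \<le> enat k"
  then have le: "Inf ?S \<le> enat k" by (simp only: mu_def)
  have "?S \<noteq> {}"
  proof
    assume "?S = {}"
    with le show False by (simp add: Inf_enat_def)
  qed
  then obtain x where "x \<in> ?S" by blast
  then have "Inf ?S \<in> ?S"
    unfolding Inf_enat_def using LeastI[of "\<lambda>y. y \<in> ?S" x] by (simp only: split: if_splits) blast
  then obtain j where "Inf ?S = enat j" "j \<ge> 1" "\<exists>w. vc_edge_weighting G j w" by blast
  with le show "\<exists>j\<ge>1. j \<le> k \<and> (\<exists>w. vc_edge_weighting G j w)" by auto
next
  assume "\<exists>j\<ge>1. j \<le> k \<and> (\<exists>w. vc_edge_weighting G j w)"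
  then obtain j where j: "j \<ge> 1" "j \<le> k" "\<exists>w. vc_edge_weighting G j w" by blast
  then have "mu G \<le> enat j" unfolding mu_def by (intro Inf_lower) auto
  also have "enat j \<le> enat k" using j(2) by simp
  finally show "mu G \<le> enat k" .
qed

lemma simple_complete_graph: "simple_graph (complete_graph n)"
  by (auto simp: simple_graph_def complete_graph_def)

lemma simple_path_graph: "simple_graph (path_graph n)"
  by (auto simp: simple_graph_def path_graph_def)

lemma simple_cycle_graph:
  assumes "n \<ge> 3" shows "simple_graph (cycle_graph n)"
proof -
  have "i \<noteq> Suc i mod n \<and> Suc i mod n < n" if "i < n" for i
    using assms that by (cases "Suc i = n") auto
  then show ?thesis by (auto simp: simple_graph_def cycle_graph_def card_insert_if)
qed

lemma simple_cart_prod: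
  assumes "simple_graph G" "simple_graph H"
  shows "simple_graph (G \<box> H)"
proof -
  have G: "u \<noteq> v" if "{u, v} \<in> edges G" for u v
    using assms(1) that unfolding simple_graph_def by fastforce
  have H: "u \<noteq> v" if "{u, v} \<in> edges H" for u v
    using assms(2) that unfolding simple_graph_def by fastforce
  have "e \<subseteq> verts (G \<box> H) \<and> card e = 2" if e: "e \<in> edges (G \<box> H)" for e
  proof -
    obtain u v u' v' where e_def: "e = {(u, v), (u', v')}"
      and mem: "u \<in> verts G" "u' \<in> verts G" "v \<in> verts H" "v' \<in> verts H"
      and adj: "u = u' \<and> {v, v'} \<in> edges H \<or> v = v' \<and> {u, u'} \<in> edges G"
      using e unfolding cart_prod_def by auto
    from adj G H have "(u, v) \<noteq> (u', v')" by blast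
    then show ?thesis using mem by (simp add: e_def cart_prod_def)
  qed
  moreover have "finite (verts (G \<box> H))"
    using assms by (simp add: simple_graph_def cart_prod_def)
  ultimately show ?thesis by (simp add: simple_graph_def)
qed

lemma simple_cart_prod_list:
  "(\<And>G. G \<in> set Gs \<Longrightarrow> simple_graph G) \<Longrightarrow> simple_graph (cart_prod_list Gs)"
proof (induction Gs)
  case Nil
  show ?case by (simp add: simple_graph_def)
next
  case (Cons G Gs)
  let ?f = "\<lambda>(x :: 'a, xs). x # xs"
  have s: "simple_graph (G \<box> cart_prod_list Gs)"
    using Cons by (intro simple_cart_prod) auto
  have "card (?f ` e) = card e" for e
    by (rule card_image) (auto simp: inj_on_def)
  moreover have "?f ` e \<subseteq> ?f ` V" if "e \<subseteq> V" for e V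
    using that by (rule image_mono)
  ultimately show ?case
    using s unfolding simple_graph_def relabel_def cart_prod_list.simps
    by (simp add: ball_simps)
qed

end

theory Submission
  imports Defs
begin

text \<open>
  The Cartesian product adds induced colours. Give an edge of \<open>G \<box> H\<close> the weight of its projection
  to the factor in which its ends differ. The edges at \<open>(u, v)\<close> are a copy of the edges of \<open>G\<close> at
  \<open>u\<close> and a copy of the edges of \<open>H\<close> at \<open>v\<close>, so the colour of \<open>(u, v)\<close> is \<open>c\<^sub>G u + c\<^sub>H v\<close>. Adjacent
  vertices agree in one coordinate, hence in one summand, and are adjacent in the other, so their
  colours differ as soon as \<open>c\<^sub>G\<close> and \<open>c\<^sub>H\<close> are proper (\<open>vc_edge_weighting_cart_prod\<close>). By
  induction a product of graphs that have a vertex-coloring \<open>k\<close>-edge-weighting has one as well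
  (\<open>vc_edge_weighting_cart_prod_list\<close>), and it remains to find weightings with \<open>k = 3\<close> for the
  three kinds of factors.

  On a path or a cycle, two consecutive vertices share the edge between them, so their
  colours differ iff the edges before and after the shared one have different weights, where a
  missing edge at the end of a path counts as weight \<open>0\<close>. Weights \<open>1, 1, 2, 2, 1, 1, \<dots>\<close> achieve
  this, and on a cycle of length at least \<open>4\<close> the last two edges get weight \<open>3\<close> to avoid a clash
  where the sequence wraps around (\<open>vc_edge_weighting_path\<close>, \<open>vc_edge_weighting_cycle\<close>).

  In a complete graph all colours have to be distinct. The weight of the edge \<open>ij\<close> is made to
  depend on whether \<open>i + j\<close> is below, equal to or above the threshold \<open>2 * (n div 2)\<close>; then the
  colour of \<open>i\<close> strictly increases with \<open>i\<close> (\<open>vc_edge_weighting_complete\<close>). The triangle is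
  treated as a complete graph.
\<close>

section \<open>Neighbourhood sums\<close>

definition nbrs :: "'a sgraph \<Rightarrow> 'a \<Rightarrow> 'a set" where
  "nbrs G v = {u. {u, v} \<in> edges G}"

lemma simple_graph_edgeD:
  assumes "simple_graph G" "{u, v} \<in> edges G"
  shows "u \<in> verts G" "v \<in> verts G" "u \<noteq> v"
  using assms unfolding simple_graph_def by fastforce+

lemma nbrs_subset_verts: "simple_graph G \<Longrightarrow> nbrs G v \<subseteq> verts G"
  by (auto simp: nbrs_def dest: simple_graph_edgeD)

lemma finite_nbrs: "simple_graph G \<Longrightarrow> finite (nbrs G v)"
  by (rule finite_subset[OF nbrs_subset_verts]) (auto simp: simple_graph_def)

text \<open>
  Summing over neighbours instead of incident edges makes the colours of a product and of an
  isomorphic copy computable by reindexing vertices.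
\<close>

lemma induced_coloring_nbrs:
  assumes "simple_graph G"
  shows "induced_coloring G w v = (\<Sum>u\<in>nbrs G v. w {u, v})"
proof -
  have "bij_betw (\<lambda>u. {u, v}) (nbrs G v) {e. e \<in> edges G \<and> v \<in> e}"
    unfolding bij_betw_def
  proof
    show "inj_on (\<lambda>u. {u, v}) (nbrs G v)"
      by (auto simp: inj_on_def doubleton_eq_iff)
    have "e \<in> (\<lambda>u. {u, v}) ` nbrs G v" if "e \<in> edges G" "v \<in> e" for e
    proof -
      have "card e = 2" using assms that by (auto simp: simple_graph_def)
      then obtain x y where "e = {x, y}" by (auto simp: card_2_iff)
      with that obtain u where "e = {u, v}" by auto
      with that show ?thesis by (auto simp: nbrs_def)
    qed
    then show "(\<lambda>u. {u, v}) ` nbrs G v = {e. e \<in> edges G \<and> v \<in> e}"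
      by (auto simp: nbrs_def)
  qed
  from sum.reindex_bij_betw[OF this, of w] show ?thesis
    by (simp add: induced_coloring_def)
qed

section \<open>Isomorphic copies\<close>

lemma vc_edge_weighting_iso:
  assumes "simple_graph G" "simple_graph H" "G \<simeq> H"
    and w: "vc_edge_weighting H k w"
  shows "\<exists>w'. vc_edge_weighting G k w'"
proof -
  obtain f where bij: "bij_betw f (verts G) (verts H)"
    and adj: "\<And>u v. u \<in> verts G \<Longrightarrow> v \<in> verts G \<Longrightarrow> {u, v} \<in> edges G \<longleftrightarrow> {f u, f v} \<in> edges H"
    using assms(3) unfolding graph_iso_def by blast
  let ?w = "\<lambda>e. w (f ` e)"
  have col: "induced_coloring G ?w v = induced_coloring H w (f v)" if v: "v \<in> verts G" for v
  proof -
    have "nbrs H (f v) = f ` nbrs G v"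
    proof (intro set_eqI iffI)
      fix y assume y: "y \<in> nbrs H (f v)"
      then have "y \<in> verts H" using nbrs_subset_verts[OF assms(2)] by blast
      then obtain x where "x \<in> verts G" "y = f x"
        using bij by (auto simp: bij_betw_def)
      with y v adj show "y \<in> f ` nbrs G v" by (auto simp: nbrs_def)
    next
      fix y assume "y \<in> f ` nbrs G v"
      then show "y \<in> nbrs H (f v)"
        using nbrs_subset_verts[OF assms(1)] adj v by (fastforce simp: nbrs_def)
    qed
    moreover have "inj_on f (nbrs G v)"
      using bij nbrs_subset_verts[OF assms(1)] by (auto simp: bij_betw_def intro: inj_on_subset)
    ultimately show ?thesis
      by (simp add: induced_coloring_nbrs assms(1,2) sum.reindex)
  qed
  have edge: "f ` e \<in> edges H" if "e \<in> edges G" for e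
  proof -
    have "card e = 2" using assms(1) that by (auto simp: simple_graph_def)
    then obtain x y where e: "e = {x, y}" by (auto simp: card_2_iff)
    with that assms(1) have "x \<in> verts G" "y \<in> verts G"
      by (auto dest: simple_graph_edgeD)
    with that adj e show ?thesis by simp
  qed
  have "induced_coloring G ?w u \<noteq> induced_coloring G ?w v" if e: "{u, v} \<in> edges G" for u v
    using simple_graph_edgeD[OF assms(1) e] edge[OF e] w
    by (simp add: col vc_edge_weighting_def proper_coloring_def)
  with w edge have "vc_edge_weighting G k ?w"
    by (simp add: vc_edge_weighting_def edge_weighting_def proper_coloring_def)
  then show ?thesis by blast
qed

lemma graph_iso_relabel:
  assumes "inj f"
  shows "relabel f G \<simeq> G"
  unfolding graph_iso_def
proof (intro exI[of _ "inv f"] conjI ballI)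
  show "bij_betw (inv f) (verts (relabel f G)) (verts G)"
    using assms by (simp add: relabel_def bij_betw_def inj_on_def image_image)
next
  fix u v assume "u \<in> verts (relabel f G)" "v \<in> verts (relabel f G)"
  then obtain x y where xy: "u = f x" "v = f y" by (auto simp: relabel_def)
  have "{f x, f y} = f ` e \<longleftrightarrow> {x, y} = e" for e
    using inj_image_eq_iff[OF assms, of "{x, y}" e] by simp
  then show "{u, v} \<in> edges (relabel f G) \<longleftrightarrow> {inv f u, inv f v} \<in> edges G"
    using assms by (auto simp: relabel_def xy image_iff)
qed

section \<open>Cartesian products\<close>

lemma cart_prod_edge_iff:
  assumes "simple_graph G" "simple_graph H"
  shows "{(u, v), (u', v')} \<in> edges (G \<box> H) \<longleftrightarrow>
    u = u' \<and> u \<in> verts G \<and> {v, v'} \<in> edges H \<or> v = v' \<and> v \<in> verts H \<and> {u, u'} \<in> edges G"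
    (is "?L \<longleftrightarrow> ?R")
proof
  show ?L if ?R
  proof -
    have "u \<in> verts G" "u' \<in> verts G" "v \<in> verts H" "v' \<in> verts H"
      using that simple_graph_edgeD[OF assms(1)] simple_graph_edgeD[OF assms(2)] by blast+
    then show ?thesis using that by (simp add: cart_prod_def) blast
  qed
  show ?R if ?L
    using that by (auto simp: cart_prod_def doubleton_eq_iff insert_commute)
qed

lemma nbrs_cart_prod:
  assumes "simple_graph G" "simple_graph H" "u \<in> verts G" "v \<in> verts H"
  shows "nbrs (G \<box> H) (u, v) = (\<lambda>x. (x, v)) ` nbrs G u \<union> Pair u ` nbrs H v"
  using assms by (auto simp: nbrs_def cart_prod_edge_iff)

text \<open>
  An edge of a product is constant in exactly one coordinate, which is the one whose image is a
  singleton; the weight is read off in the other one.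
\<close>

definition prod_weighting :: "('a set \<Rightarrow> nat) \<Rightarrow> ('b set \<Rightarrow> nat) \<Rightarrow> ('a \<times> 'b) set \<Rightarrow> nat" where
  "prod_weighting wG wH e = (if card (fst ` e) = 1 then wH (snd ` e) else wG (fst ` e))"

lemma prod_weighting_snd: "prod_weighting wG wH {(u, v), (u, v')} = wH {v, v'}"
  by (simp add: prod_weighting_def)

lemma prod_weighting_fst: "u \<noteq> u' \<Longrightarrow> prod_weighting wG wH {(u, v), (u', v)} = wG {u, u'}"
  by (simp add: prod_weighting_def)

lemma induced_coloring_cart_prod:
  assumes G: "simple_graph G" and H: "simple_graph H" and "u \<in> verts G" "v \<in> verts H"
  shows "induced_coloring (G \<box> H) (prod_weighting wG wH) (u, v)
    = induced_coloring G wG u + induced_coloring H wH v"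
proof -
  let ?w = "prod_weighting wG wH"
  have "induced_coloring (G \<box> H) ?w (u, v)
    = (\<Sum>p\<in>(\<lambda>x. (x, v)) ` nbrs G u \<union> Pair u ` nbrs H v. ?w {p, (u, v)})"
    using assms by (simp add: induced_coloring_nbrs simple_cart_prod nbrs_cart_prod)
  also have "\<dots> = (\<Sum>p\<in>(\<lambda>x. (x, v)) ` nbrs G u. ?w {p, (u, v)})
    + (\<Sum>p\<in>Pair u ` nbrs H v. ?w {p, (u, v)})"
  proof (rule sum.union_disjoint)
    show "(\<lambda>x. (x, v)) ` nbrs G u \<inter> Pair u ` nbrs H v = {}"
      using simple_graph_edgeD(3)[OF G] by (auto simp: nbrs_def)
  qed (simp_all add: finite_nbrs G H)
  also have "\<dots> = (\<Sum>x\<in>nbrs G u. ?w {(x, v), (u, v)}) + (\<Sum>y\<in>nbrs H v. ?w {(u, y), (u, v)})"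
    by (simp add: sum.reindex inj_on_def)
  also have "(\<Sum>x\<in>nbrs G u. ?w {(x, v), (u, v)}) = (\<Sum>x\<in>nbrs G u. wG {x, u})"
    using simple_graph_edgeD(3)[OF G]
    by (intro sum.cong refl prod_weighting_fst) (auto simp: nbrs_def)
  finally show ?thesis
    by (simp add: prod_weighting_snd induced_coloring_nbrs G H)
qed

lemma vc_edge_weighting_cart_prod:
  assumes G: "simple_graph G" and H: "simple_graph H"
    and wG: "vc_edge_weighting G k wG" and wH: "vc_edge_weighting H k wH"
  shows "vc_edge_weighting (G \<box> H) k (prod_weighting wG wH)"
  unfolding vc_edge_weighting_def edge_weighting_def proper_coloring_def
proof (intro conjI ballI allI impI)
  fix e assume e: "e \<in> edges (G \<box> H)"
  then obtain u v u' v' where e_def: "e = {(u, v), (u', v')}"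
    by (auto simp: cart_prod_def)
  with e have "u = u' \<and> {v, v'} \<in> edges H \<or> v = v' \<and> {u, u'} \<in> edges G"
    by (simp add: cart_prod_edge_iff G H) blast
  then show "prod_weighting wG wH e \<in> {1..k}"
    using wG wH simple_graph_edgeD(3)[OF G, of u u']
    by (auto simp: e_def prod_weighting_fst prod_weighting_snd vc_edge_weighting_def
        edge_weighting_def simp del: atLeastAtMost_iff)
next
  fix p q assume e: "{p, q} \<in> edges (G \<box> H)"
  obtain u v u' v' where pq: "p = (u, v)" "q = (u', v')" by fastforce
  have "p \<in> verts (G \<box> H)" "q \<in> verts (G \<box> H)"
    using simple_graph_edgeD[OF simple_cart_prod[OF G H] e] by auto
  then have "u \<in> verts G" "v \<in> verts H" "u' \<in> verts G" "v' \<in> verts H"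
    by (auto simp: pq cart_prod_def)
  then show "induced_coloring (G \<box> H) (prod_weighting wG wH) p
    \<noteq> induced_coloring (G \<box> H) (prod_weighting wG wH) q"
    using e wG wH
    by (auto simp: pq cart_prod_edge_iff G H induced_coloring_cart_prod vc_edge_weighting_def
        proper_coloring_def)
qed

lemma vc_edge_weighting_cart_prod_list:
  assumes "\<And>G. G \<in> set Gs \<Longrightarrow> simple_graph G"
    and "\<And>G. G \<in> set Gs \<Longrightarrow> \<exists>w. vc_edge_weighting G k w"
  shows "\<exists>w. vc_edge_weighting (cart_prod_list Gs) k w"
  using assms
proof (induction Gs)
  case Nil
  show ?case by (simp add: vc_edge_weighting_def edge_weighting_def proper_coloring_def)
next
  case (Cons G Gs)
  let ?P = "G \<box> cart_prod_list Gs"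
  obtain w where w: "vc_edge_weighting (cart_prod_list Gs) k w"
    using Cons by auto
  obtain wG where wG: "vc_edge_weighting G k wG" using Cons.prems by auto
  have s: "simple_graph G" "simple_graph (cart_prod_list Gs)"
    "simple_graph (cart_prod_list (G # Gs))"
    using Cons.prems(1) by (auto intro!: simple_cart_prod_list simp del: cart_prod_list.simps)
  have "cart_prod_list (G # Gs) \<simeq> ?P"
    unfolding cart_prod_list.simps by (rule graph_iso_relabel) (auto simp: inj_on_def)
  from vc_edge_weighting_iso[OF s(3) _ this vc_edge_weighting_cart_prod[OF s(1,2) wG w]]
  show ?case by (simp add: simple_cart_prod s del: cart_prod_list.simps)
qed

section \<open>Complete graphs\<close>

definition threshold_weight :: "nat \<Rightarrow> nat \<Rightarrow> nat" where
  "threshold_weight t s = (if s < t then 1 else if s = t then 2 else 3)"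

text \<open>
  For \<open>i < i'\<close>, the weights satisfy \<open>w {i, j} \<le> w {i', j}\<close> for every third vertex \<open>j\<close>, and the edge
  \<open>ii'\<close> counts for both colours. The colours therefore differ once a third vertex \<open>j\<close> has
  \<open>i + j \<le> t \<le> i' + j\<close>, that is, \<open>t - i' \<le> j \<le> t - i\<close>. In general the lower end point will
  do. It is \<open>i\<close> itself if \<open>i + i' = t\<close>; then the interval is that from \<open>i\<close> to \<open>i'\<close>, and it has
  the inner point \<open>m\<close> because \<open>t = 2 * m\<close> is even. It is \<open>i'\<close> itself if \<open>i' = m\<close>; then the next
  point \<open>m + 1\<close> is still at most \<open>t - i\<close>, and it is a vertex because \<open>n \<ge> 3\<close>.
\<close>

lemma separating_third_vertex:
  fixes i i' n :: nat
  assumes "n \<ge> 3" "i < i'" "i' < n"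
  obtains j where "j < n" "j \<noteq> i" "j \<noteq> i'"
    "i + j \<le> 2 * (n div 2)" "2 * (n div 2) \<le> i' + j"
proof -
  define m where "m = n div 2"
  have m: "n = 2 * m \<or> n = 2 * m + 1" unfolding m_def by presburger
  consider "i + i' = 2 * m" | "i' = m" | "i + i' \<noteq> 2 * m" "i' \<noteq> m" by blast
  then show thesis
  proof cases
    case 1
    then show ?thesis using that[of m] assms m unfolding m_def[symmetric] by linarith
  next
    case 2
    then show ?thesis using that[of "m + 1"] assms m unfolding m_def[symmetric] by linarith
  next
    case 3
    then show ?thesis using that[of "2 * m - i'"] assms m unfolding m_def[symmetric] by linarith
  qed
qed

lemma vc_edge_weighting_complete:
  assumes "n \<ge> 3"
  shows "vc_edge_weighting (complete_graph n) 3 (\<lambda>e. threshold_weight (2 * (n div 2)) (\<Sum>e))"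
proof -
  let ?t = "2 * (n div 2)"
  let ?w = "\<lambda>e. threshold_weight ?t (\<Sum>e)"
  let ?W = "\<lambda>i j. threshold_weight ?t (i + j)"
  let ?c = "induced_coloring (complete_graph n) ?w"
  have col: "?c i = (\<Sum>j\<in>{..<n} - {i}. ?W i j)" if "i < n" for i
  proof -
    have "nbrs (complete_graph n) i = {..<n} - {i}"
      using that by (auto simp: nbrs_def complete_graph_def doubleton_eq_iff)
    moreover have "?w {j, i} = ?W i j" if "j \<noteq> i" for j
      using that by (simp add: add.commute)
    ultimately show ?thesis
      by (simp add: induced_coloring_nbrs simple_complete_graph)
  qed
  have less: "?c i < ?c i'" if "i < i'" "i' < n" for i i'
  proof -
    let ?R = "{..<n} - {i, i'}"
    obtain j where j: "j < n" "j \<noteq> i" "j \<noteq> i'" "i + j \<le> ?t" "?t \<le> i' + j"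
      using separating_third_vertex[OF assms \<open>i < i'\<close> \<open>i' < n\<close>] by blast
    have "(\<Sum>j\<in>?R. ?W i j) < (\<Sum>j\<in>?R. ?W i' j)"
    proof (rule sum_strict_mono_ex1)
      show "\<forall>j\<in>?R. ?W i j \<le> ?W i' j"
        using that by (auto simp: threshold_weight_def)
      show "\<exists>j\<in>?R. ?W i j < ?W i' j"
        using that j by (intro bexI[of _ j]) (auto simp: threshold_weight_def)
    qed simp
    moreover have "?c i = ?W i i' + (\<Sum>j\<in>?R. ?W i j)"
    proof -
      have "{..<n} - {i} = insert i' ?R" using that by auto
      then have "(\<Sum>j\<in>{..<n} - {i}. ?W i j) = (\<Sum>j\<in>insert i' ?R. ?W i j)"
        by (rule sum.cong) simp
      also have "\<dots> = ?W i i' + (\<Sum>j\<in>?R. ?W i j)" by (rule sum.insert) auto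
      finally show ?thesis using that col[of i] by linarith
    qed
    moreover have "?c i' = ?W i' i + (\<Sum>j\<in>?R. ?W i' j)"
    proof -
      have "{..<n} - {i'} = insert i ?R" using that by auto
      then have "(\<Sum>j\<in>{..<n} - {i'}. ?W i' j) = (\<Sum>j\<in>insert i ?R. ?W i' j)"
        by (rule sum.cong) simp
      also have "\<dots> = ?W i' i + (\<Sum>j\<in>?R. ?W i' j)" by (rule sum.insert) auto
      finally show ?thesis using that col[of i'] by linarith
    qed
    moreover have "?W i i' = ?W i' i" by (simp only: add.commute)
    ultimately show ?thesis by linarith
  qed
  have "?c u \<noteq> ?c v" if "{u, v} \<in> edges (complete_graph n)" for u v
  proof -
    have "u < n" "v < n" "u \<noteq> v"
      using that by (auto simp: complete_graph_def doubleton_eq_iff)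
    then show ?thesis using less[of u v] less[of v u] by (cases u v rule: linorder_cases) auto
  qed
  then show ?thesis
    by (simp add: vc_edge_weighting_def edge_weighting_def proper_coloring_def
        threshold_weight_def)
qed

section \<open>Paths and cycles\<close>

text \<open>The sequence \<open>1, 1, 2, 2, 1, 1, 2, 2, \<dots>\<close>, in which terms two places apart differ.\<close>

definition alternating_pairs :: "nat \<Rightarrow> nat" where
  "alternating_pairs i = 1 + (i div 2) mod 2"

lemma alternating_pairs_range: "1 \<le> alternating_pairs i" "alternating_pairs i \<le> 2"
  unfolding alternating_pairs_def by presburger+

lemma alternating_pairs_neq: "alternating_pairs (Suc (Suc i)) \<noteq> alternating_pairs i"
  unfolding alternating_pairs_def by (simp add: mod_Suc)

lemma nbrs_path:
  assumes "v < n"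
  shows "nbrs (path_graph n) v = {u. Suc u = v} \<union> (if Suc v < n then {Suc v} else {})"
  using assms by (auto simp: nbrs_def path_graph_def doubleton_eq_iff)

lemma vc_edge_weighting_path:
  assumes "n \<ge> 3"
  shows "vc_edge_weighting (path_graph n) 3 (\<lambda>e. alternating_pairs (Min e))"
proof -
  let ?w = "\<lambda>e. alternating_pairs (Min e)"
  let ?c = "induced_coloring (path_graph n) ?w"
  have c0: "?c 0 = alternating_pairs 0"
    using assms by (simp add: induced_coloring_nbrs simple_path_graph nbrs_path)
  have cS: "?c (Suc v) = alternating_pairs v
      + (if Suc (Suc v) < n then alternating_pairs (Suc v) else 0)" if "Suc v < n" for v
    using that by (simp add: induced_coloring_nbrs simple_path_graph nbrs_path)
  have step: "?c i \<noteq> ?c (Suc i)" if "Suc i < n" for i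
  proof (cases i)
    case 0
    then show ?thesis using assms alternating_pairs_range(1)[of 1] by (simp add: c0 cS)
  next
    case (Suc j)
    then show ?thesis
      using that alternating_pairs_neq[of j] alternating_pairs_range(1)[of j] by (simp add: cS)
  qed
  have "?c u \<noteq> ?c v" if "{u, v} \<in> edges (path_graph n)" for u v
  proof -
    from that obtain i where "Suc i < n" "u = i \<and> v = Suc i \<or> v = i \<and> u = Suc i"
      by (auto simp: path_graph_def doubleton_eq_iff)
    with step[of i] show ?thesis by auto
  qed
  moreover have "?w e \<in> {1..3}" for e
    using alternating_pairs_range[of "Min e"] by simp
  ultimately show ?thesis
    by (simp add: vc_edge_weighting_def edge_weighting_def proper_coloring_def)
qed

lemma cycle_3_eq_complete_3: "cycle_graph 3 = complete_graph 3"
proof -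
  have lt3: "i < 3 \<longleftrightarrow> i = 0 \<or> i = 1 \<or> i = 2" for i :: nat by arith
  have "{{i, Suc i mod 3} | i. i < 3} = {{0, 1}, {1, 2}, {2, 0 :: nat}}"
    unfolding lt3 by (simp add: ex_disj_distrib conj_disj_distribL Collect_disj_eq numeral_2_eq_2)
      blast
  moreover have "{{i, j} | i j. i < 3 \<and> j < 3 \<and> i \<noteq> j} = {{0, 1}, {1, 2}, {2, 0 :: nat}}"
    unfolding lt3
    by (simp add: ex_disj_distrib conj_disj_distribL conj_disj_distribR Collect_disj_eq)
      (auto simp: insert_commute)
  ultimately show ?thesis by (simp add: cycle_graph_def complete_graph_def)
qed

text \<open>
  Edge \<open>i\<close> joins \<open>i\<close> to its successor. The cyclic condition compares edge \<open>n - 2\<close> with edge \<open>0\<close> and edge \<open>n - 1\<close> with edge \<open>1\<close>. Weight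
  \<open>3\<close> on the last two edges settles both comparisons, provided that edge \<open>1\<close> is not itself one of
  the last two, that is, \<open>n \<ge> 4\<close>; the two heavy edges are never compared with each other.
\<close>

definition cycle_weight :: "nat \<Rightarrow> nat \<Rightarrow> nat" where
  "cycle_weight n i = (if n \<le> i + 2 then 3 else alternating_pairs i)"

lemma vc_edge_weighting_cycle_ge_4:
  assumes "n \<ge> 4"
  shows "\<exists>w. vc_edge_weighting (cycle_graph n) 3 w"
proof -
  let ?a = "cycle_weight n"
  (* Every edge except the one closing the cycle has its index as its minimum. *)
  define w where "w e = (if e = {n - 1, 0} then ?a (n - 1) else ?a (Min e))" for e
  let ?c = "induced_coloring (cycle_graph n) w"
  have simple: "simple_graph (cycle_graph n)" using assms by (simp add: simple_cycle_graph)
  have succ: "Suc i mod n = (if Suc i = n then 0 else Suc i)" if "i < n" for i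
    using that by auto
  have edge_iff: "{u, v} \<in> edges (cycle_graph n) \<longleftrightarrow> u < n \<and> v < n \<and>
     (v = Suc u \<or> u = Suc v \<or> u = 0 \<and> v = n - 1 \<or> v = 0 \<and> u = n - 1)" for u v
  proof -
    have "{u, v} \<in> edges (cycle_graph n) \<longleftrightarrow>
        u < n \<and> v = Suc u mod n \<or> v < n \<and> u = Suc v mod n"
      by (auto simp: cycle_graph_def doubleton_eq_iff)
    also have "\<dots> \<longleftrightarrow> u < n \<and> v < n \<and>
        (v = Suc u \<or> u = Suc v \<or> u = 0 \<and> v = n - 1 \<or> v = 0 \<and> u = n - 1)"
      using assms by (cases "u < n"; cases "v < n") (auto simp: succ)
    finally show ?thesis .
  qed
  have w_step: "w {i, Suc i} = ?a i" "w {Suc i, i} = ?a i" for i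
    using assms by (auto simp: w_def doubleton_eq_iff)
  have w_close: "w {n - 1, 0} = ?a (n - 1)" "w {0, n - 1} = ?a (n - 1)"
    by (auto simp: w_def insert_commute)
  have c0: "?c 0 = ?a (n - 1) + ?a 0"
  proof -
    have "nbrs (cycle_graph n) 0 = {n - 1, Suc 0}"
      using assms by (auto simp: nbrs_def edge_iff)
    then show ?thesis
      using assms w_step[of 0] w_close by (simp add: induced_coloring_nbrs simple)
  qed
  have cS: "?c (Suc i) = ?a i + ?a (Suc i)" if "Suc i < n" for i
  proof (cases "Suc (Suc i) = n")
    case True
    then have "nbrs (cycle_graph n) (Suc i) = {i, 0}" and "Suc i = n - 1"
      using assms by (auto simp: nbrs_def edge_iff)
    then show ?thesis
      using assms w_step[of i] w_close by (simp add: induced_coloring_nbrs simple)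
  next
    case False
    then have "nbrs (cycle_graph n) (Suc i) = {i, Suc (Suc i)}"
      using assms that by (auto simp: nbrs_def edge_iff)
    then show ?thesis
      using w_step[of i] w_step[of "Suc i"] by (simp add: induced_coloring_nbrs simple)
  qed
  have a_neq: "?a i \<noteq> ?a (Suc (Suc i))" if "Suc (Suc i) < n" for i
    using that alternating_pairs_neq[of i] alternating_pairs_range(2)[of i]
    by (auto simp: cycle_weight_def)
  have a_start: "?a 0 = 1" "?a 1 = 1"
    using assms by (auto simp: cycle_weight_def alternating_pairs_def)
  have a_end: "?a (n - 2) = 3" "?a (n - 1) = 3"
    using assms by (auto simp: cycle_weight_def)
  have step: "?c i \<noteq> ?c (Suc i)" if "Suc i < n" for i
  proof (cases i)
    case 0
    then show ?thesis using assms a_start a_end by (simp add: c0 cS)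
  next
    case (Suc j)
    then show ?thesis using that a_neq[of j] by (simp add: cS)
  qed
  have close: "?c (n - 1) \<noteq> ?c 0"
  proof -
    have "n - 1 = Suc (n - 2)" using assms by simp
    then show ?thesis using assms a_start a_end cS[of "n - 2"] by (simp add: c0)
  qed
  have "?c u \<noteq> ?c v" if "{u, v} \<in> edges (cycle_graph n)" for u v
    using that[unfolded edge_iff] step[of u] step[of v] close by metis
  moreover have "w e \<in> {1..3}" for e
  proof -
    have "?a i \<in> {1..3}" for i
      using alternating_pairs_range[of i] by (simp add: cycle_weight_def)
    then show ?thesis by (simp add: w_def)
  qed
  ultimately have "vc_edge_weighting (cycle_graph n) 3 w"
    unfolding vc_edge_weighting_def edge_weighting_def proper_coloring_def by blast
  then show ?thesis by blast
qed

lemma vc_edge_weighting_cycle: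
  assumes "n \<ge> 3"
  shows "\<exists>w. vc_edge_weighting (cycle_graph n) 3 w"
proof (cases "n = 3")
  case True
  then show ?thesis using vc_edge_weighting_complete[of 3] by (auto simp: cycle_3_eq_complete_3)
next
  case False
  then show ?thesis using assms by (intro vc_edge_weighting_cycle_ge_4) simp
qed

section \<open>Products of paths, cycles and complete graphs\<close>

lemma mu_le_3:
  assumes "\<exists>w. vc_edge_weighting G 3 w"
  shows "mu G \<le> 3"
proof -
  have "mu G \<le> enat 3"
    unfolding mu_le_iff using assms by (intro exI[of _ 3]) simp
  then show ?thesis by (simp only: numeral_eq_enat)
qed

lemma vc_edge_weighting_factors:
  assumes "n \<ge> 3"
  shows "\<exists>w. vc_edge_weighting (complete_graph n) 3 w"
    "\<exists>w. vc_edge_weighting (cycle_graph n) 3 w"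
    "\<exists>w. vc_edge_weighting (path_graph n) 3 w"
  using vc_edge_weighting_complete[OF assms] vc_edge_weighting_cycle[OF assms]
    vc_edge_weighting_path[OF assms] by blast+

lemmas simple_factors = simple_complete_graph simple_cycle_graph simple_path_graph

lemma vc_edge_weighting_iso_factor:
  assumes "simple_graph G" "n \<ge> 3"
    and "G \<simeq> complete_graph n \<or> G \<simeq> cycle_graph n \<or> G \<simeq> path_graph n"
  shows "\<exists>w. vc_edge_weighting G 3 w"
proof -
  have transfer: "\<exists>w. vc_edge_weighting G 3 w"
    if "simple_graph H" "\<exists>w. vc_edge_weighting H 3 w" "G \<simeq> H" for H :: "nat sgraph"
    using that vc_edge_weighting_iso[OF assms(1)] by blast
  from assms(3) show ?thesis
    by (elim disjE)
      (rule transfer; (assumption | intro simple_factors vc_edge_weighting_factors assms(2)))+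
qed

theorem corollary2p2:
  "(\<forall>Gs :: 'a sgraph list.
      length Gs \<ge> 2 \<longrightarrow>
      (\<forall>G\<in>set Gs. simple_graph G \<and>
         (\<exists>n\<ge>3. G \<simeq> complete_graph n \<or> G \<simeq> cycle_graph n \<or> G \<simeq> path_graph n)) \<longrightarrow>
      mu (cart_prod_list Gs) \<le> 3) \<and>
   (\<forall>n\<ge>3. \<forall>m\<ge>3. mu (cycle_graph n \<box> path_graph m) \<le> 3) \<and>
   (\<forall>n\<ge>3. \<forall>m\<ge>3. mu (complete_graph n \<box> path_graph m) \<le> 3) \<and>
   (\<forall>n\<ge>3. \<forall>m\<ge>3. mu (complete_graph n \<box> cycle_graph m) \<le> 3) \<and>
   (\<forall>ns. length ns \<ge> 2 \<longrightarrow> (\<forall>n\<in>set ns. n \<ge> 3) \<longrightarrow>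
      mu (cart_prod_list (map cycle_graph ns)) \<le> 3) \<and>
   (\<forall>ns. length ns \<ge> 2 \<longrightarrow> (\<forall>n\<in>set ns. n \<ge> 3) \<longrightarrow>
      mu (cart_prod_list (map path_graph ns)) \<le> 3) \<and>
   (\<forall>ns. length ns \<ge> 2 \<longrightarrow> (\<forall>n\<in>set ns. n \<ge> 3) \<longrightarrow>
      mu (cart_prod_list (map complete_graph ns)) \<le> 3)"
proof (intro conjI allI impI)
  have binary: "mu (G \<box> H) \<le> 3"
    if "simple_graph G" "simple_graph H"
      "\<exists>w. vc_edge_weighting G 3 w" "\<exists>w. vc_edge_weighting H 3 w"
    for G H :: "nat sgraph"
    using that by (intro mu_le_3) (blast intro: vc_edge_weighting_cart_prod)
  {
    fix Gs :: "'a sgraph list"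
    assume *: "\<forall>G\<in>set Gs. simple_graph G \<and>
      (\<exists>n\<ge>3. G \<simeq> complete_graph n \<or> G \<simeq> cycle_graph n \<or> G \<simeq> path_graph n)"
    show "mu (cart_prod_list Gs) \<le> 3"
    proof (intro mu_le_3 vc_edge_weighting_cart_prod_list)
      fix G assume "G \<in> set Gs"
      with * obtain n where "simple_graph G" "n \<ge> 3"
        "G \<simeq> complete_graph n \<or> G \<simeq> cycle_graph n \<or> G \<simeq> path_graph n"
        by blast
      then show "simple_graph G" "\<exists>w. vc_edge_weighting G 3 w"
        using vc_edge_weighting_iso_factor by blast+
    qed
  }
  fix n m :: nat
  assume nm: "n \<ge> 3" "m \<ge> 3"
  show "mu (cycle_graph n \<box> path_graph m) \<le> 3"
    by (intro binary simple_factors vc_edge_weighting_factors nm)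
  show "mu (complete_graph n \<box> path_graph m) \<le> 3"
    by (intro binary simple_factors vc_edge_weighting_factors nm)
  show "mu (complete_graph n \<box> cycle_graph m) \<le> 3"
    by (intro binary simple_factors vc_edge_weighting_factors nm)
next
  fix ns :: "nat list"
  assume ns: "\<forall>n\<in>set ns. n \<ge> 3"
  have list: "mu (cart_prod_list (map F ns)) \<le> 3"
    if "\<And>n. n \<ge> 3 \<Longrightarrow> simple_graph (F n)" "\<And>n. n \<ge> 3 \<Longrightarrow> \<exists>w. vc_edge_weighting (F n) 3 w"
    for F :: "nat \<Rightarrow> nat sgraph"
    using that ns by (intro mu_le_3 vc_edge_weighting_cart_prod_list) auto
  show "mu (cart_prod_list (map cycle_graph ns)) \<le> 3"
    by (intro list simple_factors vc_edge_weighting_factors)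
  show "mu (cart_prod_list (map path_graph ns)) \<le> 3"
    by (intro list simple_factors vc_edge_weighting_factors)
  show "mu (cart_prod_list (map complete_graph ns)) \<le> 3"
    by (intro list simple_factors vc_edge_weighting_factors)
qed

end
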